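(* Let $\widehat{\mathbb R}=\{\pm\infty\}\cup\mathbb R$ be the ordered set of extended real numbers. Let $\mathcal O$ be a (partially) ordered set, let $\mathcal S\subseteq\mathcal O$ be any subset (with the induced order) and let $\psi:\mathcal S\to\widehat{\mathbb R}$ be an order preserving function. Then the set of order preserving functions $f:\mathcal O\to\widehat{\mathbb R}$ whose restriction to $\mathcal S$ coincides with $\psi$ has a maximum and a minimum.
   Context: A function $f$ between partially ordered sets is order preserving if $x\le y$ implies $f(x)\le f(y)$. Order preserving functions are ordered pointwise: $f\le g$ if and only if $f(x)\le g(x)$ for all $x\in\mathcal O$; maximum and minimum are with respect to this order. *)

theory Defs
  imports "HOL-Library.Extended_Real" "HOL-Library.FuncSet"
begin

text \<open>
  An ordered set is a carrier set \<open>X\<close>, possibly empty, in a type of class \<open>order\<close>.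
  A map \<open>X \<rightarrow> ereal\<close> is represented by a unique function on the whole type, namely the one
  that is \<open>undefined\<close> outside \<open>X\<close>; this is what \<open>\<rightarrow>\<^sub>E\<close> enforces.
  The values of \<open>\<psi>\<close> outside \<open>S\<close> are irrelevant.
\<close>

definition mono_extensions :: "'a::order set \<Rightarrow> 'a set \<Rightarrow> ('a \<Rightarrow> ereal) \<Rightarrow> ('a \<Rightarrow> ereal) set"
  where "mono_extensions X S \<psi> =
    {f \<in> X \<rightarrow>\<^sub>E UNIV. mono_on X f \<and> (\<forall>x\<in>S. f x = \<psi> x)}"

definition has_pointwise_max :: "'a set \<Rightarrow> ('a \<Rightarrow> 'b::order) set \<Rightarrow> bool"
  where "has_pointwise_max X F \<longleftrightarrow> (\<exists>g\<in>F. \<forall>f\<in>F. \<forall>x\<in>X. f x \<le> g x)"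

definition has_pointwise_min :: "'a set \<Rightarrow> ('a \<Rightarrow> 'b::order) set \<Rightarrow> bool"
  where "has_pointwise_min X F \<longleftrightarrow> (\<exists>g\<in>F. \<forall>f\<in>F. \<forall>x\<in>X. g x \<le> f x)"

end

theory Submission
  imports Defs
begin

text \<open>
  Monotonicity bounds the value at \<open>x\<close> of any extension \<open>f\<close> from both sides: if \<open>s \<le> x \<le> t\<close>
  with \<open>s, t \<in> S\<close>, then \<open>\<psi> s = f s \<le> f x \<le> f t = \<psi> t\<close>. The best upper bound obtained
  in this way is the infimum of \<open>\<psi>\<close> over the points of \<open>S\<close> above \<open>x\<close>, and the best lower
  bound is the supremum of \<open>\<psi>\<close> over the points of \<open>S\<close> below \<open>x\<close>; both exist because the
  extended reals form a complete lattice. As \<open>x\<close> grows, fewer points of \<open>S\<close> lie above it and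
  more lie below it, so both bounds are monotone in \<open>x\<close>. At \<open>x \<in> S\<close> they are attained at \<open>x\<close>
  itself, as \<open>\<psi>\<close> is monotone. Hence the bounds are themselves extensions, and therefore the
  maximum and the minimum.
\<close>

text \<open>
  Where no point of \<open>S\<close> lies above \<open>x\<close>, the infimum is empty and the value is \<open>\<infinity>\<close>;
  dually, the lower extension below takes the value \<open>-\<infinity>\<close> where no point of \<open>S\<close> lies below.
\<close>

definition upper_extension :: "'a::order set \<Rightarrow> 'a set \<Rightarrow> ('a \<Rightarrow> ereal) \<Rightarrow> 'a \<Rightarrow> ereal"
  where "upper_extension X S \<psi> = (\<lambda>x\<in>X. INF s\<in>{s\<in>S. x \<le> s}. \<psi> s)"

definition lower_extension :: "'a::order set \<Rightarrow> 'a set \<Rightarrow> ('a \<Rightarrow> ereal) \<Rightarrow> 'a \<Rightarrow> ereal"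
  where "lower_extension X S \<psi> = (\<lambda>x\<in>X. SUP s\<in>{s\<in>S. s \<le> x}. \<psi> s)"

lemma upper_extension_in_mono_extensions:
  assumes "S \<subseteq> X" and "mono_on S \<psi>"
  shows "upper_extension X S \<psi> \<in> mono_extensions X S \<psi>"
proof -
  have "mono_on X (upper_extension X S \<psi>)"
    by (rule mono_onI) (auto simp: upper_extension_def intro!: INF_superset_mono)
  moreover have "upper_extension X S \<psi> x = \<psi> x" if "x \<in> S" for x
  proof -
    have "(INF s\<in>{s\<in>S. x \<le> s}. \<psi> s) = \<psi> x"
      using that assms(2) by (intro antisym INF_lower INF_greatest) (auto dest: mono_onD)
    then show ?thesis
      using that assms(1) by (auto simp: upper_extension_def)
  qed
  ultimately show ?thesis
    by (simp add: mono_extensions_def upper_extension_def)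
qed

lemma lower_extension_in_mono_extensions:
  assumes "S \<subseteq> X" and "mono_on S \<psi>"
  shows "lower_extension X S \<psi> \<in> mono_extensions X S \<psi>"
proof -
  have "mono_on X (lower_extension X S \<psi>)"
    by (rule mono_onI) (auto simp: lower_extension_def intro!: SUP_subset_mono)
  moreover have "lower_extension X S \<psi> x = \<psi> x" if "x \<in> S" for x
  proof -
    have "(SUP s\<in>{s\<in>S. s \<le> x}. \<psi> s) = \<psi> x"
      using that assms(2) by (intro antisym SUP_upper SUP_least) (auto dest: mono_onD)
    then show ?thesis
      using that assms(1) by (auto simp: lower_extension_def)
  qed
  ultimately show ?thesis
    by (simp add: mono_extensions_def lower_extension_def)
qed

lemma mono_extension_le_upper_extension:
  assumes "S \<subseteq> X" and "f \<in> mono_extensions X S \<psi>" and "x \<in> X"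
  shows "f x \<le> upper_extension X S \<psi> x"
proof -
  have "f x \<le> \<psi> s" if "s \<in> S" "x \<le> s" for s
  proof -
    have "f x \<le> f s"
      using assms that by (intro mono_onD[of X f]) (auto simp: mono_extensions_def)
    also have "f s = \<psi> s"
      using assms(2) that(1) by (simp add: mono_extensions_def)
    finally show ?thesis .
  qed
  then show ?thesis
    using assms(3) by (auto simp: upper_extension_def intro: INF_greatest)
qed

lemma lower_extension_le_mono_extension:
  assumes "S \<subseteq> X" and "f \<in> mono_extensions X S \<psi>" and "x \<in> X"
  shows "lower_extension X S \<psi> x \<le> f x"
proof -
  have "\<psi> s \<le> f x" if "s \<in> S" "s \<le> x" for s
  proof -
    have "\<psi> s = f s"
      using assms(2) that(1) by (simp add: mono_extensions_def)
    also have "f s \<le> f x"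
      using assms that by (intro mono_onD[of X f]) (auto simp: mono_extensions_def)
    finally show ?thesis .
  qed
  then show ?thesis
    using assms(3) by (auto simp: lower_extension_def intro: SUP_least)
qed

theorem lemma1p1:
  fixes X S :: "'a::order set" and \<psi> :: "'a \<Rightarrow> ereal"
  assumes "S \<subseteq> X"
    and "mono_on S \<psi>"
  shows "has_pointwise_max X (mono_extensions X S \<psi>)
       \<and> has_pointwise_min X (mono_extensions X S \<psi>)"
proof
  show "has_pointwise_max X (mono_extensions X S \<psi>)"
    unfolding has_pointwise_max_def
    using upper_extension_in_mono_extensions[OF assms]
      mono_extension_le_upper_extension[OF assms(1)] by blast
  show "has_pointwise_min X (mono_extensions X S \<psi>)"
    unfolding has_pointwise_min_def
    using lower_extension_in_mono_extensions[OF assms]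
      lower_extension_le_mono_extension[OF assms(1)] by blast
qed

end
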